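(* Let $M$ be an $m$-dimensional closed manifold $(m\geq 1)$, and let $i : M\rightarrow \mathbb{R}^{m+1}$ be an immersion with normal crossings. Then there exist $p_1,\ldots,p_{m+1}\in i(M)$ such that $D_{(p_1,\ldots,p_{m+1})}\circ i : M\rightarrow \mathbb{R}^{m+1}$ is an immersion with normal crossings.
   Context: All manifolds and mappings are of class $C^\infty$. A closed manifold is a compact manifold without boundary. $d(x,y)=\sqrt{\sum_{j=1}^n(x_j-y_j)^2}$ is the Euclidean distance on $\mathbb{R}^n$. For points $p_1,\ldots,p_\ell\in\mathbb{R}^n$ ($\ell\ge1$), the distance-squared mapping $D_{(p_1,\ldots,p_\ell)}:\mathbb{R}^n\to\mathbb{R}^\ell$ is defined by $D_{(p_1,\ldots,p_\ell)}(x)=(d^2(p_1,x),\ldots,d^2(p_\ell,x))$, where $d^2(p,x)=d(p,x)^2$. Here it is used with $n=\ell=m+1$. Let $M,N$ be manifolds. An immersion $f:M\to N$ is with normal crossings at a point $y\in N$ if $f^{-1}(y)$ is a finite set $\{x_1,\ldots,x_k\}$ (distinct points) and for any subset $\{\lambda_1,\ldots,\lambda_s\}\subset\{1,\ldots,k\}$ ($s\le k$, the $\lambda_j$ distinct), $$\mathrm{codim}\Bigl(\bigcap_{j=1}^s df_{x_{\lambda_j}}(T_{x_{\lambda_j}}M)\Bigr)=\sum_{j=1}^s\mathrm{codim}\bigl(df_{x_{\lambda_j}}(T_{x_{\lambda_j}}M)\bigr),$$ where $\mathrm{codim}\,H=\dim T_yN-\dim H$ for a linear subspace $H$ of $T_yN$.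 An immersion $f:M\to N$ is with normal crossings if it is with normal crossings at every point $y\in N$. *)

theory Defs
  imports "HOL-Analysis.Analysis"
begin

section \<open>Smooth maps between open subsets of Euclidean spaces\<close>

text \<open>
  Only used for open \<open>S\<close>: \<open>f\<close> is of class \<open>C\<^sup>k\<close> on \<open>S\<close> iff it is differentiable and all its
  directional derivatives are of class \<open>C\<^sup>k\<^sup>-\<^sup>1\<close>.
\<close>

primrec Ck_on :: "nat \<Rightarrow> 'a::euclidean_space set \<Rightarrow> ('a \<Rightarrow> 'b::euclidean_space) \<Rightarrow> bool" where
  "Ck_on 0 S f \<longleftrightarrow> continuous_on S f"
| "Ck_on (Suc k) S f \<longleftrightarrow>
     (\<forall>x\<in>S. f differentiable (at x)) \<and>
     (\<forall>v. Ck_on k S (\<lambda>x. frechet_derivative f (at x) v))"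

definition smooth_on :: "'a::euclidean_space set \<Rightarrow> ('a \<Rightarrow> 'b::euclidean_space) \<Rightarrow> bool" where
  "smooth_on S f \<longleftrightarrow> (\<forall>k. Ck_on k S f)"

section \<open>Smooth manifolds\<close>

text \<open>
  A chart with values in \<open>\<real>\<^sup>m\<close> is a pair \<open>(U, \<phi>)\<close>. The map \<open>\<phi>\<close> is a total function whose values
  outside \<open>U\<close> are irrelevant.
\<close>

type_synonym ('a, 'm) chart = "'a set \<times> ('a \<Rightarrow> real ^ 'm)"

definition chart_inv :: "('a, 'm) chart \<Rightarrow> real ^ 'm \<Rightarrow> 'a" where
  "chart_inv c = inv_into (fst c) (snd c)"

definition is_chart :: "'a topology \<Rightarrow> ('a, 'm::finite) chart \<Rightarrow> bool" where
  "is_chart X c \<longleftrightarrow>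
     openin X (fst c) \<and> open (snd c ` fst c) \<and>
     homeomorphic_map (subtopology X (fst c)) (top_of_set (snd c ` fst c)) (snd c)"

text \<open>
  The atlas is not required to be maximal; smoothness, tangent spaces and differentials below do
  not depend on the choice of an atlas within its equivalence class.
\<close>

definition smooth_manifold :: "'a topology \<Rightarrow> ('a, 'm::finite) chart set \<Rightarrow> bool" where
  "smooth_manifold X A \<longleftrightarrow>
     Hausdorff_space X \<and> second_countable X \<and>
     (\<forall>c\<in>A. is_chart X c) \<and> (\<Union>c\<in>A. fst c) = topspace X \<and>
     (\<forall>c\<in>A. \<forall>d\<in>A. smooth_on (snd c ` (fst c \<inter> fst d)) (snd d \<circ> chart_inv c))"

definition closed_manifold :: "'a topology \<Rightarrow> ('a, 'm::finite) chart set \<Rightarrow> bool" where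
  "closed_manifold X A \<longleftrightarrow> smooth_manifold X A \<and> compact_space X"

definition charts_at :: "('a, 'm) chart set \<Rightarrow> 'a \<Rightarrow> ('a, 'm) chart set" where
  "charts_at A x = {c\<in>A. x \<in> fst c}"

text \<open>
  A tangent vector at \<open>x\<close> is a family of coordinate vectors, one for each chart around \<open>x\<close>, that
  transforms by the Jacobians of the coordinate changes. The value \<open>0\<close> at the other charts makes
  the representation unique.
\<close>

definition tangent_space ::
    "('a, 'm::finite) chart set \<Rightarrow> 'a \<Rightarrow> (('a, 'm) chart \<Rightarrow> real ^ 'm) set" where
  "tangent_space A x =
     {v. (\<forall>c. c \<notin> charts_at A x \<longrightarrow> v c = 0) \<and>
         (\<forall>c\<in>charts_at A x. \<forall>d\<in>charts_at A x.
            v d = frechet_derivative (snd d \<circ> chart_inv c) (at (snd c x)) (v c))}"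

section \<open>Immersions with normal crossings into a Euclidean space\<close>

definition smooth_map ::
    "('a, 'm::finite) chart set \<Rightarrow> ('a \<Rightarrow> 'b::euclidean_space) \<Rightarrow> bool" where
  "smooth_map A f \<longleftrightarrow> (\<forall>c\<in>A. smooth_on (snd c ` fst c) (f \<circ> chart_inv c))"

text \<open>
  The differential \<open>df\<^sub>x\<close>, with \<open>T\<^sub>y \<real>\<^sup>n\<close> identified with \<open>\<real>\<^sup>n\<close>. By the chain rule the result on
  \<open>tangent_space A x\<close> does not depend on the chosen chart.
\<close>

definition differential ::
    "('a, 'm::finite) chart set \<Rightarrow> ('a \<Rightarrow> 'b::euclidean_space) \<Rightarrow> 'a \<Rightarrow>
     (('a, 'm) chart \<Rightarrow> real ^ 'm) \<Rightarrow> 'b" where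
  "differential A f x v =
     (let c = (SOME c. c \<in> charts_at A x)
      in frechet_derivative (f \<circ> chart_inv c) (at (snd c x)) (v c))"

definition immersion ::
    "'a topology \<Rightarrow> ('a, 'm::finite) chart set \<Rightarrow> ('a \<Rightarrow> 'b::euclidean_space) \<Rightarrow> bool" where
  "immersion X A f \<longleftrightarrow>
     smooth_map A f \<and> (\<forall>x\<in>topspace X. inj_on (differential A f x) (tangent_space A x))"

definition codim :: "'b::euclidean_space set \<Rightarrow> nat" where
  "codim H = DIM('b) - dim H"

text \<open>
  For \<open>S = {}\<close> the intersection is the whole space and the condition reads \<open>0 = 0\<close>.
\<close>

definition normal_crossings_at ::
    "'a topology \<Rightarrow> ('a, 'm::finite) chart set \<Rightarrow> ('a \<Rightarrow> 'b::euclidean_space) \<Rightarrow> 'b \<Rightarrow> bool" where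
  "normal_crossings_at X A f y \<longleftrightarrow>
     finite {x \<in> topspace X. f x = y} \<and>
     (\<forall>S \<subseteq> {x \<in> topspace X. f x = y}.
        codim (\<Inter>x\<in>S. differential A f x ` tangent_space A x) =
        (\<Sum>x\<in>S. codim (differential A f x ` tangent_space A x)))"

definition immersion_with_normal_crossings ::
    "'a topology \<Rightarrow> ('a, 'm::finite) chart set \<Rightarrow> ('a \<Rightarrow> 'b::euclidean_space) \<Rightarrow> bool" where
  "immersion_with_normal_crossings X A f \<longleftrightarrow>
     immersion X A f \<and> (\<forall>y. normal_crossings_at X A f y)"

section \<open>Distance-squared mappings\<close>

definition distance_squared_mapping ::
    "('l::finite \<Rightarrow> real ^ 'n::finite) \<Rightarrow> real ^ 'n \<Rightarrow> real ^ 'l" where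
  "distance_squared_mapping p x = (\<chi> j. (dist (p j) x)\<^sup>2)"

end

theory Submission
  imports Defs
begin

text \<open>
  If the points \<open>p j\<close> affinely span a hyperplane \<open>H\<close> with unit normal \<open>\<nu>\<close>, the distance-squared mapping
  \<open>D\<close> of \<open>p\<close> is a fold along \<open>H\<close>: two points have the same image iff they are equal or mirror images
  in \<open>H\<close> (\<open>distance_squared_fibre\<close>), the differential is invertible off \<open>H\<close>, and on \<open>H\<close> its kernel is
  spanned by \<open>\<nu>\<close> (\<open>distance_squared_kernel\<close>). Hence \<open>D \<circ> i\<close> is an immersion with normal crossings as soon
  as \<open>H\<close> satisfies two conditions: \<open>\<nu>\<close> is not tangent to the image of \<open>i\<close> at any point over \<open>H\<close>, and no
  two distinct points of \<open>M\<close> are mapped by \<open>i\<close> to mirror images, a point of \<open>H\<close> being its own mirror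
  image. Indeed, a fibre of \<open>D \<circ> i\<close> is then either a single point, where there is nothing to check, or a
  fibre of \<open>i\<close> off \<open>H\<close>, whose tangent hyperplanes are carried over by one linear isomorphism.

  It remains to find such an \<open>H\<close> spanned by points of the image of \<open>i\<close>. Since \<open>M\<close> is compact, there are a
  point \<open>q\<close> and a direction \<open>\<nu>\<close> such that \<open>i x \<bullet> \<nu>\<close> has a strict maximum at \<open>q\<close>
  (\<open>strict_extreme_point_exists\<close>). A hyperplane \<open>H\<close> orthogonal to \<open>\<nu>\<close> and slightly below \<open>i q\<close> cuts off a
  small cap. Near \<open>q\<close> the image of \<open>i\<close> is a graph over \<open>H\<close>, which excludes vertical tangents and
  mirror pairs, and the intersection of the image with \<open>H\<close> spans \<open>H\<close> because it bounds the cap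
  (\<open>cap_hyperplane_exists\<close>).
\<close>

section \<open>Closure properties of maps of class \<open>C\<^sup>k\<close>\<close>

lemma Ck_on_cong:
  assumes "open S" and "\<And>x. x \<in> S \<Longrightarrow> f x = g x"
  shows "Ck_on k S f \<longleftrightarrow> Ck_on k S g"
  using assms(2)
proof (induction k arbitrary: f g)
  case 0
  then show ?case by (auto cong: continuous_on_cong)
next
  case (Suc k)
  have imp: "g' differentiable (at x) \<and> frechet_derivative f' (at x) = frechet_derivative g' (at x)"
    if "x \<in> S" "f' differentiable (at x)" "\<And>x. x \<in> S \<Longrightarrow> f' x = g' x" for x and f' g' :: "'a \<Rightarrow> 'b"
  proof -
    have "(f' has_derivative frechet_derivative f' (at x)) (at x)"
      using that by (simp add: frechet_derivative_works)
    then have "(g' has_derivative frechet_derivative f' (at x)) (at x)"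
      using has_derivative_transform_within_open[OF _ \<open>open S\<close> \<open>x \<in> S\<close>] that(3) by blast
    then show ?thesis
      using frechet_derivative_at differentiable_def by blast
  qed
  have d: "(\<forall>x\<in>S. f differentiable (at x)) \<longleftrightarrow> (\<forall>x\<in>S. g differentiable (at x))"
    using imp[of _ f g] imp[of _ g f] Suc.prems by metis
  show ?case
  proof (cases "\<forall>x\<in>S. f differentiable (at x)")
    case True
    have "Ck_on k S (\<lambda>x. frechet_derivative f (at x) v) \<longleftrightarrow>
          Ck_on k S (\<lambda>x. frechet_derivative g (at x) v)" for v
      by (rule Suc.IH) (use imp[of _ f g] Suc.prems True in metis)
    with True d show ?thesis by simp
  next
    case False
    with d show ?thesis by auto
  qed
qed

text \<open>
  Lets a derivative be given by an explicit formula, so that the closure properties below follow by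
  induction on \<open>k\<close> from the differentiation rules.
\<close>

lemma Ck_on_SucI:
  assumes "open S"
    and "\<And>x. x \<in> S \<Longrightarrow> (f has_derivative f' x) (at x)"
    and "\<And>v. Ck_on k S (\<lambda>x. f' x v)"
  shows "Ck_on (Suc k) S f"
proof -
  have "Ck_on k S (\<lambda>x. frechet_derivative f (at x) v)" for v
    using Ck_on_cong[OF \<open>open S\<close>, of "\<lambda>x. frechet_derivative f (at x) v" "\<lambda>x. f' x v"]
      assms(2,3) frechet_derivative_at by metis
  then show ?thesis
    using assms(2) by (auto simp: differentiable_def)
qed

lemma Ck_on_Suc_has_derivative:
  "Ck_on (Suc k) S f \<Longrightarrow> x \<in> S \<Longrightarrow> (f has_derivative frechet_derivative f (at x)) (at x)"
  by (simp add: frechet_derivative_works)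

lemma Ck_on_SucD: "Ck_on (Suc k) S f \<Longrightarrow> Ck_on k S f"
proof (induction k arbitrary: f)
  case 0
  then show ?case
    by (simp add: continuous_at_imp_continuous_on differentiable_imp_continuous_within)
qed auto

lemma Ck_on_const: "Ck_on k S (\<lambda>x. c)"
  by (induction k arbitrary: c) auto

lemma Ck_on_add:
  assumes "open S" "Ck_on k S f" "Ck_on k S g"
  shows "Ck_on k S (\<lambda>x. f x + g x)"
  using assms(2,3)
proof (induction k arbitrary: f g)
  case 0
  then show ?case by (auto intro: continuous_intros)
next
  case (Suc k)
  show ?case
    by (rule Ck_on_SucI[OF assms(1) has_derivative_add[OF Ck_on_Suc_has_derivative
            Ck_on_Suc_has_derivative]])
       (use Suc in auto)
qed

lemma Ck_on_bounded_linear: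
  assumes "open S" "bounded_linear L" "Ck_on k S f"
  shows "Ck_on k S (\<lambda>x. L (f x))"
  using assms(3)
proof (induction k arbitrary: f)
  case 0
  then show ?case
    using bounded_linear.continuous_on[OF assms(2)] by simp
next
  case (Suc k)
  show ?case
    by (rule Ck_on_SucI[OF assms(1) bounded_linear.has_derivative[OF assms(2)
            Ck_on_Suc_has_derivative]])
       (use Suc in auto)
qed

text \<open>
  The product rule expresses the derivative by inner products of maps of class \<open>C\<^sup>k\<close>, which the
  induction hypothesis covers for arbitrary factors.
\<close>

lemma Ck_on_inner:
  assumes "open S" "Ck_on k S f" "Ck_on k S g"
  shows "Ck_on k S (\<lambda>x. f x \<bullet> g x)"
  using assms(2,3)
proof (induction k arbitrary: f g)
  case 0
  then show ?case by (auto intro: continuous_intros)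
next
  case (Suc k)
  show ?case
  proof (rule Ck_on_SucI[OF assms(1) has_derivative_inner[OF Ck_on_Suc_has_derivative
            Ck_on_Suc_has_derivative]])
    show "Ck_on k S (\<lambda>x. f x \<bullet> frechet_derivative g (at x) v +
                         frechet_derivative f (at x) v \<bullet> g x)" for v
      using Suc Ck_on_SucD[OF Suc.prems(1)] Ck_on_SucD[OF Suc.prems(2)]
      by (intro Ck_on_add assms(1) Suc.IH) auto
  qed (use Suc.prems in auto)
qed

text \<open>
  Each component of the distance-squared mapping is a quadratic polynomial, with quadratic part
  \<open>g x \<bullet> g x\<close> common to all components.
\<close>

lemma smooth_on_distance_squared:
  fixes g :: "'a::euclidean_space \<Rightarrow> real ^ 'n::finite" and p :: "'l::finite \<Rightarrow> real ^ 'n"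
  assumes "open S" "smooth_on S g"
  shows "smooth_on S (distance_squared_mapping p \<circ> g)"
proof -
  have eq: "distance_squared_mapping p \<circ> g =
    (\<lambda>x. (\<chi> j. p j \<bullet> p j) + ((\<chi> j. - 2 * (p j \<bullet> g x)) + (g x \<bullet> g x) *\<^sub>R (\<chi> j. 1)))"
    by (auto simp: fun_eq_iff distance_squared_mapping_def vec_eq_iff dist_norm power2_norm_eq_inner
        inner_diff_left inner_diff_right inner_commute)
  have "linear (\<lambda>y. (\<chi> j. - 2 * (p j \<bullet> y)) :: real ^ 'l)"
    by (rule linearI) (auto simp: vec_eq_iff inner_add_right algebra_simps)
  then have "bounded_linear (\<lambda>y. (\<chi> j. - 2 * (p j \<bullet> y)) :: real ^ 'l)"
    by (simp add: linear_conv_bounded_linear)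
  then have "Ck_on k S (distance_squared_mapping p \<circ> g)" for k
    unfolding eq using assms unfolding smooth_on_def
    by (intro Ck_on_add Ck_on_const Ck_on_inner Ck_on_bounded_linear[OF _ bounded_linear_scaleR_left]
         Ck_on_bounded_linear[where L="\<lambda>y. (\<chi> j. - 2 * (p j \<bullet> y)) :: real ^ 'l"]) auto
  then show ?thesis by (simp add: smooth_on_def)
qed

section \<open>Charts, tangent vectors and differentials\<close>

lemma is_chart_inv: "is_chart X c \<Longrightarrow> x \<in> fst c \<Longrightarrow> chart_inv c (snd c x) = x"
  unfolding is_chart_def chart_inv_def
  by (metis homeomorphic_imp_injective_map inf.absorb_iff2 inv_into_f_f openin_subset
      topspace_subtopology)

lemma is_chart_open_image:
  assumes "is_chart X c" "openin X W" "W \<subseteq> fst c"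
  shows "open (snd c ` W)"
proof -
  have "openin (subtopology X (fst c)) W"
    using assms by (auto simp: openin_subtopology intro!: exI[of _ W])
  then have "openin (top_of_set (snd c ` fst c)) (snd c ` W)"
    using assms(1) unfolding is_chart_def
    by (meson homeomorphic_imp_open_map open_map_def)
  then show ?thesis
    using assms(1) unfolding is_chart_def by (metis openin_open_trans)
qed

lemma is_chart_open_preimage:
  assumes "is_chart X c" "open B"
  shows "openin X {x \<in> fst c. snd c x \<in> B}"
proof -
  have sub: "fst c \<subseteq> topspace X" using assms(1) by (simp add: is_chart_def openin_subset)
  have "continuous_map (subtopology X (fst c)) euclidean (snd c)"
    using assms(1) unfolding is_chart_def
    by (meson continuous_map_in_subtopology homeomorphic_imp_continuous_map)
  then have "openin (subtopology X (fst c)) {x \<in> fst c. snd c x \<in> B}"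
    using assms(2) sub unfolding continuous_map_def by (simp add: inf_absorb2)
  then show ?thesis
    using assms(1) unfolding is_chart_def by (meson openin_trans_full)
qed

lemma charts_at_nonempty: "smooth_manifold X A \<Longrightarrow> x \<in> topspace X \<Longrightarrow> \<exists>c. c \<in> charts_at A x"
  unfolding smooth_manifold_def charts_at_def by blast

lemma charts_at_topspace: "smooth_manifold X A \<Longrightarrow> c \<in> charts_at A x \<Longrightarrow> x \<in> topspace X"
  unfolding smooth_manifold_def charts_at_def by blast

text \<open>
  The chain rule for \<open>f \<circ> c\<^sup>-\<^sup>1 = (f \<circ> d\<^sup>-\<^sup>1) \<circ> (d \<circ> c\<^sup>-\<^sup>1)\<close>. With \<open>f\<close> a chart it is the cocycle condition on
  tangent vectors; with \<open>f\<close> a map on the manifold it makes the differential chart-independent.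
\<close>

lemma chart_change_has_derivative:
  fixes f :: "'a \<Rightarrow> 'b::euclidean_space"
  assumes X: "smooth_manifold X A" and c: "c \<in> charts_at A x" and d: "d \<in> charts_at A x"
    and f: "((f \<circ> chart_inv d) has_derivative f') (at (snd d x))"
  shows "((f \<circ> chart_inv c) has_derivative
          f' \<circ> frechet_derivative (snd d \<circ> chart_inv c) (at (snd c x))) (at (snd c x))"
proof -
  have cd: "c \<in> A" "d \<in> A" "x \<in> fst c \<inter> fst d"
    using c d by (auto simp: charts_at_def)
  have ch: "is_chart X c" "is_chart X d" using X cd by (auto simp: smooth_manifold_def)
  have inv: "chart_inv c (snd c z) = z" if "z \<in> fst c \<inter> fst d" for z
    using is_chart_inv[OF ch(1)] that by blast
  have op: "open (snd c ` (fst c \<inter> fst d))"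
    using is_chart_open_image[OF ch(1) openin_Int] ch by (simp add: is_chart_def)
  have "smooth_on (snd c ` (fst c \<inter> fst d)) (snd d \<circ> chart_inv c)"
    using X cd by (simp add: smooth_manifold_def)
  then have t: "((snd d \<circ> chart_inv c) has_derivative
      frechet_derivative (snd d \<circ> chart_inv c) (at (snd c x))) (at (snd c x))"
    using Ck_on_Suc_has_derivative cd(3) unfolding smooth_on_def by blast
  have "(((f \<circ> chart_inv d) \<circ> (snd d \<circ> chart_inv c)) has_derivative
          f' \<circ> frechet_derivative (snd d \<circ> chart_inv c) (at (snd c x))) (at (snd c x))"
    by (rule diff_chain_at[OF t]) (use f inv cd(3) in simp)
  then show ?thesis
  proof (rule has_derivative_transform_within_open[OF _ op])
    show "snd c x \<in> snd c ` (fst c \<inter> fst d)" using cd by blast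
    fix y assume "y \<in> snd c ` (fst c \<inter> fst d)"
    then obtain z where z: "z \<in> fst c \<inter> fst d" "y = snd c z" by blast
    then show "((f \<circ> chart_inv d) \<circ> (snd d \<circ> chart_inv c)) y = (f \<circ> chart_inv c) y"
      using inv is_chart_inv[OF ch(2)] by simp
  qed
qed

lemma smooth_map_has_derivative:
  assumes "smooth_map A f" "c \<in> charts_at A x"
  shows "((f \<circ> chart_inv c) has_derivative frechet_derivative (f \<circ> chart_inv c) (at (snd c x)))
          (at (snd c x))"
  using assms Ck_on_Suc_has_derivative unfolding smooth_map_def smooth_on_def charts_at_def by blast

text \<open>
  The family is obtained by transporting \<open>w\<close> from \<open>c\<close> to every other chart by the Jacobians; its
  consistency is the cocycle condition.
\<close>

lemma tangent_vector_exists: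
  fixes A :: "('a, 'm::finite) chart set"
  assumes X: "smooth_manifold X A" and c: "c \<in> charts_at A x"
  shows "\<exists>v\<in>tangent_space A x. v c = w"
proof -
  define J where "J d = frechet_derivative (snd d \<circ> chart_inv c) (at (snd c x))" for d :: "('a, 'm) chart"
  define v where "v d = (if d \<in> charts_at A x then J d w else 0)" for d :: "('a, 'm) chart"
  have trans: "((snd e \<circ> chart_inv d) has_derivative
      frechet_derivative (snd e \<circ> chart_inv d) (at (snd d x))) (at (snd d x))"
    if "d \<in> charts_at A x" "e \<in> charts_at A x" for d e
  proof -
    have "smooth_on (snd d ` (fst d \<inter> fst e)) (snd e \<circ> chart_inv d)"
      using X that by (simp add: smooth_manifold_def charts_at_def)
    then show ?thesis
      using Ck_on_Suc_has_derivative that unfolding smooth_on_def charts_at_def by blast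
  qed
  have "v e = frechet_derivative (snd e \<circ> chart_inv d) (at (snd d x)) (v d)"
    if d: "d \<in> charts_at A x" and e: "e \<in> charts_at A x" for d e
    using frechet_derivative_at[OF chart_change_has_derivative[OF X c d trans[OF d e]]] d e
    by (simp add: v_def J_def fun_eq_iff)
  moreover have "\<forall>d. d \<notin> charts_at A x \<longrightarrow> v d = 0" by (simp add: v_def)
  ultimately have "v \<in> tangent_space A x"
    unfolding tangent_space_def by blast
  moreover have "v c = w"
  proof -
    have ch: "is_chart X c" "x \<in> fst c" using X c by (auto simp: smooth_manifold_def charts_at_def)
    then have op: "open (snd c ` fst c)" by (simp add: is_chart_def)
    have id: "w = (snd c \<circ> chart_inv c) w" if "w \<in> snd c ` fst c" for w
      using that is_chart_inv[OF ch(1)] by auto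
    have "((snd c \<circ> chart_inv c) has_derivative (\<lambda>w. w)) (at (snd c x))"
      by (rule has_derivative_transform_within_open[OF has_derivative_ident op _ id])
        (use ch in auto)
    from fun_cong[OF frechet_derivative_at[OF this], of w] show ?thesis
      using c by (simp add: v_def J_def)
  qed
  ultimately show ?thesis by blast
qed

lemma differential_in_chart:
  assumes X: "smooth_manifold X A" and f: "smooth_map A f" and c: "c \<in> charts_at A x"
    and v: "v \<in> tangent_space A x"
  shows "differential A f x v = frechet_derivative (f \<circ> chart_inv c) (at (snd c x)) (v c)"
proof -
  define d where "d = (SOME c. c \<in> charts_at A x)"
  have d: "d \<in> charts_at A x" unfolding d_def using c by (rule someI)
  have "v c = frechet_derivative (snd c \<circ> chart_inv d) (at (snd d x)) (v d)"
    using v c d unfolding tangent_space_def by blast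
  then show ?thesis
    using fun_cong[OF frechet_derivative_at[OF chart_change_has_derivative[OF X d c
          smooth_map_has_derivative[OF f c]]], of "v d"]
    unfolding differential_def Let_def d_def[symmetric] by simp
qed

text \<open>
  The tangent image can thus be computed in any chart around the point, in particular in one fixed
  chart for all points near a given one.
\<close>

lemma differential_image:
  assumes X: "smooth_manifold X A" and f: "smooth_map A f" and c: "c \<in> charts_at A x"
  shows "differential A f x ` tangent_space A x =
         range (frechet_derivative (f \<circ> chart_inv c) (at (snd c x)))"
proof -
  let ?L = "frechet_derivative (f \<circ> chart_inv c) (at (snd c x))"
  have "differential A f x ` tangent_space A x = (\<lambda>v. ?L (v c)) ` tangent_space A x"
    using differential_in_chart[OF X f c] by (rule image_cong[OF refl])
  also have "\<dots> = ?L ` (\<lambda>v. v c) ` tangent_space A x"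
    by (simp add: image_image)
  also have "(\<lambda>v. v c) ` tangent_space A x = UNIV"
  proof -
    have "w \<in> (\<lambda>v. v c) ` tangent_space A x" for w
      using tangent_vector_exists[OF X c, of w] by blast
    then show ?thesis by blast
  qed
  finally show ?thesis .
qed

lemma immersion_inj_in_chart:
  assumes X: "smooth_manifold X A" and f: "immersion X A f" and c: "c \<in> charts_at A x"
  shows "inj (frechet_derivative (f \<circ> chart_inv c) (at (snd c x)))"
proof (rule injI)
  fix w1 w2
  assume eq: "frechet_derivative (f \<circ> chart_inv c) (at (snd c x)) w1 =
          frechet_derivative (f \<circ> chart_inv c) (at (snd c x)) w2"
  have x: "x \<in> topspace X" by (rule charts_at_topspace[OF X c])
  obtain v1 where v1: "v1 \<in> tangent_space A x" "v1 c = w1"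
    using tangent_vector_exists[OF X c] by blast
  obtain v2 where v2: "v2 \<in> tangent_space A x" "v2 c = w2"
    using tangent_vector_exists[OF X c] by blast
  have sm: "smooth_map A f" and inj: "inj_on (differential A f x) (tangent_space A x)"
    using f x by (auto simp: immersion_def)
  have "differential A f x v1 = differential A f x v2"
    using differential_in_chart[OF X sm c] v1 v2 eq by simp
  then show "w1 = w2"
    using inj_onD[OF inj] v1 v2 by blast
qed

lemma tangent_hyperplane:
  fixes f :: "'a \<Rightarrow> real ^ 'n::finite" and A :: "('a, 'm::finite) chart set"
  assumes X: "smooth_manifold X A" and f: "immersion X A f" and x: "x \<in> topspace X"
  shows "subspace (differential A f x ` tangent_space A x)"
    and "dim (differential A f x ` tangent_space A x) = CARD('m)"
proof -
  obtain c where c: "c \<in> charts_at A x" using charts_at_nonempty[OF X x] by blast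
  have sm: "smooth_map A f" using f by (simp add: immersion_def)
  define L where "L = frechet_derivative (f \<circ> chart_inv c) (at (snd c x))"
  have L: "linear L"
    unfolding L_def by (rule has_derivative_linear[OF smooth_map_has_derivative[OF sm c]])
  have inj: "inj L" unfolding L_def by (rule immersion_inj_in_chart[OF X f c])
  have im: "differential A f x ` tangent_space A x = range L"
    unfolding L_def by (rule differential_image[OF X sm c])
  show "subspace (differential A f x ` tangent_space A x)"
    unfolding im by (rule linear_subspace_image[OF L subspace_UNIV])
  show "dim (differential A f x ` tangent_space A x) = CARD('m)"
    unfolding im by (subst dim_image_eq) (use L inj in simp_all)
qed

lemma smooth_map_continuous:
  assumes X: "smooth_manifold X A" and f: "smooth_map A f"
  shows "continuous_map X euclidean f"
proof -
  have "openin X {x \<in> topspace X. f x \<in> V}" if V: "open V" for V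
  proof (subst openin_subopen, intro ballI)
    fix x assume "x \<in> {x \<in> topspace X. f x \<in> V}"
    then have x: "x \<in> topspace X" "f x \<in> V" by auto
    obtain c where "c \<in> charts_at A x" using charts_at_nonempty[OF X x(1)] by blast
    then have c: "is_chart X c" "c \<in> A" "x \<in> fst c"
      using X by (auto simp: smooth_manifold_def charts_at_def)
    have op: "open (snd c ` fst c)" using c by (simp add: is_chart_def)
    have "continuous_on (snd c ` fst c) (f \<circ> chart_inv c)"
      using f c(2) unfolding smooth_map_def smooth_on_def by (metis Ck_on.simps(1))
    then have "open ((f \<circ> chart_inv c) -` V \<inter> snd c ` fst c)"
      using continuous_on_open_vimage[OF op] V by blast
    from is_chart_open_preimage[OF c(1) this]
    have "openin X {z \<in> fst c. snd c z \<in> (f \<circ> chart_inv c) -` V \<inter> snd c ` fst c}" .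
    moreover have "{z \<in> fst c. snd c z \<in> (f \<circ> chart_inv c) -` V \<inter> snd c ` fst c} =
        {z \<in> fst c. f z \<in> V}"
      using is_chart_inv[OF c(1)] by (auto, metis)
    moreover have "fst c \<subseteq> topspace X" using c(1) by (simp add: is_chart_def openin_subset)
    ultimately show "\<exists>T. openin X T \<and> x \<in> T \<and> T \<subseteq> {x \<in> topspace X. f x \<in> V}"
      using c x by (intro exI[of _ "{z \<in> fst c. f z \<in> V}"]) auto
  qed
  then show ?thesis unfolding continuous_map_def by simp
qed

section \<open>Distance-squared mappings as fold maps\<close>

lemma distance_squared_has_derivative:
  fixes p :: "'l::finite \<Rightarrow> real ^ 'n::finite"
  shows "(distance_squared_mapping p has_derivative (\<lambda>v. \<chi> j. 2 * ((x - p j) \<bullet> v))) (at x)"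
proof -
  have "((\<lambda>x. distance_squared_mapping p x \<bullet> b) has_derivative
         (\<lambda>v. (\<chi> j. 2 * ((x - p j) \<bullet> v)) \<bullet> b)) (at x)" if "b \<in> Basis" for b :: "real ^ 'l"
  proof -
    from that obtain j where b: "b = axis j 1" by (auto simp: Basis_vec_def)
    have "((\<lambda>x. (p j - x) \<bullet> (p j - x)) has_derivative (\<lambda>v. 2 * ((x - p j) \<bullet> v))) (at x)"
      by (auto intro!: derivative_eq_intros simp: inner_commute inner_diff_left inner_diff_right)
    then show ?thesis
      by (simp add: b inner_axis distance_squared_mapping_def dist_norm
          power2_norm_eq_inner)
  qed
  then show ?thesis
    using has_derivative_componentwise_within[of "distance_squared_mapping p" _ x UNIV] by blast
qed

text \<open>
  Subtracting two components of \<open>D x = D y\<close> cancels the quadratic terms and leaves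
  \<open>(p j - p k) \<bullet> (x - y) = 0\<close>. For a unit vector \<open>\<nu>\<close> the first two hypotheses say, through
  orthogonal complements, that the \<open>p j\<close> affinely span the hyperplane orthogonal to \<open>\<nu>\<close> at height \<open>h\<close>;
  so \<open>x - y\<close> is vertical. A single component then shows that \<open>x\<close> and \<open>y\<close> are equal or lie at heights
  symmetric about \<open>h\<close>, that is, are mirror images.
\<close>

lemma distance_squared_fibre:
  fixes p :: "'l::finite \<Rightarrow> real ^ 'n::finite"
  assumes span: "\<forall>v. (\<forall>j k. (p j - p k) \<bullet> v = 0) \<longrightarrow> v = (v \<bullet> \<nu>) *\<^sub>R \<nu>"
    and h: "\<And>j. p j \<bullet> \<nu> = h"
    and eq: "distance_squared_mapping p x = distance_squared_mapping p y"
  shows "x - y = ((x - y) \<bullet> \<nu>) *\<^sub>R \<nu>" and "x = y \<or> x \<bullet> \<nu> + y \<bullet> \<nu> = 2 * h"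
proof -
  have pv: "2 * (p j \<bullet> (x - y)) = (x - y) \<bullet> (x + y)" for j
  proof -
    have "(dist (p j) x)\<^sup>2 = (dist (p j) y)\<^sup>2"
      using eq by (simp add: distance_squared_mapping_def vec_eq_iff)
    then show ?thesis
      by (simp add: dist_norm power2_norm_eq_inner inner_diff_left inner_diff_right
          inner_add_left inner_add_right inner_commute)
  qed
  have "(p j - p k) \<bullet> (x - y) = 0" for j k
    using pv[of j] pv[of k] by (simp add: inner_diff_left)
  with span show v: "x - y = ((x - y) \<bullet> \<nu>) *\<^sub>R \<nu>" by blast
  define t where "t = (x - y) \<bullet> \<nu>"
  have "2 * (t * h) = t * (x \<bullet> \<nu> + y \<bullet> \<nu>)"
    using pv v h by (metis (no_types, lifting) inner_add_right inner_commute inner_scaleR_right t_def)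
  then show "x = y \<or> x \<bullet> \<nu> + y \<bullet> \<nu> = 2 * h"
    using v by (cases "t = 0") (auto simp: t_def)
qed

text \<open>
  The infinitesimal version of the same argument: differences of components force a kernel vector to
  be vertical, \<open>v = t *\<^sub>R \<nu>\<close>, and each component then reduces to \<open>t * (x \<bullet> \<nu> - h) = 0\<close>.
\<close>

lemma distance_squared_kernel:
  fixes p :: "'l::finite \<Rightarrow> real ^ 'n::finite"
  assumes span: "\<forall>v. (\<forall>j k. (p j - p k) \<bullet> v = 0) \<longrightarrow> v = (v \<bullet> \<nu>) *\<^sub>R \<nu>"
    and h: "\<And>j. p j \<bullet> \<nu> = h"
    and eq: "(\<chi> j. 2 * ((x - p j) \<bullet> v)) = 0"
  shows "v = (v \<bullet> \<nu>) *\<^sub>R \<nu>" and "v = 0 \<or> x \<bullet> \<nu> = h"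
proof -
  have pv: "x \<bullet> v = p j \<bullet> v" for j
    using eq by (simp add: vec_eq_iff inner_diff_left)
  have "(p j - p k) \<bullet> v = 0" for j k
    using pv[of j] pv[of k] by (simp add: inner_diff_left)
  with span show v: "v = (v \<bullet> \<nu>) *\<^sub>R \<nu>" by blast
  define t where "t = v \<bullet> \<nu>"
  have "t * (x \<bullet> \<nu>) = t * h"
    using pv v h by (metis inner_scaleR_right t_def)
  then show "v = 0 \<or> x \<bullet> \<nu> = h"
    using v by (cases "t = 0") (auto simp: t_def)
qed

section \<open>A hyperplane cutting off a small cap\<close>

text \<open>
  Injectivity of the derivative at \<open>a\<close> persists nearby and makes \<open>g\<close> locally injective because the
  derivative varies continuously in operator norm. In finite dimension this
  follows from the continuity of the directional derivatives along a basis, which is what \<open>Ck_on\<close>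
  provides.
\<close>

lemma C1_injective_derivative_locally_injective:
  fixes g :: "'a::euclidean_space \<Rightarrow> 'b::euclidean_space"
  assumes O: "open O'" "a \<in> O'" and g: "Ck_on (Suc 0) O' g"
    and inj: "inj (frechet_derivative g (at a))"
  obtains r where "r > 0" "ball a r \<subseteq> O'" "inj_on g (ball a r)"
    "\<And>y. y \<in> ball a r \<Longrightarrow> inj (frechet_derivative g (at y))"
proof -
  define D where "D y = frechet_derivative g (at y)" for y
  have der: "(g has_derivative D y) (at y)" if "y \<in> O'" for y
    unfolding D_def using Ck_on_Suc_has_derivative[OF g that] .
  have lin: "linear (D y)" if "y \<in> O'" for y using der[OF that] by (rule has_derivative_linear)
  have near: "\<exists>d>0. \<forall>y. dist a y < d \<longrightarrow> y \<in> O' \<and> onorm (\<lambda>v. D y v - D a v) < e" if e: "e > 0" for e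
  proof -
    have "((\<lambda>y. \<Sum>b\<in>Basis. norm (D y b - D a b)) \<longlongrightarrow> (\<Sum>b\<in>Basis. norm (D a b - D a b))) (at a)"
    proof (intro tendsto_sum tendsto_norm tendsto_diff tendsto_const)
      fix b :: 'a
      have "continuous_on O' (\<lambda>y. D y b)" using g by (simp add: D_def)
      then show "((\<lambda>y. D y b) \<longlongrightarrow> D a b) (at a)"
        using O by (simp add: continuous_on_eq_continuous_at isCont_def)
    qed
    then have "\<forall>\<^sub>F y in at a. (\<Sum>b\<in>Basis. norm (D y b - D a b)) < e"
      by (rule order_tendstoD) (use e in simp)
    then obtain d1 where d1: "d1 > 0"
      "\<And>y. y \<noteq> a \<Longrightarrow> dist y a < d1 \<Longrightarrow> (\<Sum>b\<in>Basis. norm (D y b - D a b)) < e"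
      unfolding eventually_at by blast
    obtain d2 where d2: "d2 > 0" "ball a d2 \<subseteq> O'" using O openE by blast
    have "y \<in> O' \<and> onorm (\<lambda>v. D y v - D a v) < e" if y: "dist a y < min d1 d2" for y
    proof
      show yO: "y \<in> O'" using y d2 by auto
      have "bounded_linear (\<lambda>v. D y v - D a v)"
        using lin[OF yO] lin[OF O(2)] by (simp add: bounded_linear_sub linear_conv_bounded_linear)
      then have "onorm (\<lambda>v. D y v - D a v) \<le> (\<Sum>b\<in>Basis. norm (D y b - D a b))"
        by (rule onorm_componentwise)
      also have "\<dots> < e" using d1(2)[of y] y e by (cases "y = a") (auto simp: dist_commute)
      finally show "onorm (\<lambda>v. D y v - D a v) < e" .
    qed
    then show ?thesis using d1(1) d2(1) by (intro exI[of _ "min d1 d2"]) auto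
  qed
  have injD: "inj (D a)" using inj by (simp add: D_def)
  obtain g' where g': "linear g'" "g' \<circ> D a = id"
    using linear_injective_left_inverse[OF lin[OF O(2)] injD] by blast
  have "\<exists>d>0. \<forall>y. dist a y < d \<longrightarrow> onorm (\<lambda>v. D y v - D a v) < e" if "e > 0" for e
    using near[OF that] by blast
  note onorm_near = this
  have "bounded_linear g'" using g'(1) by (simp add: linear_conv_bounded_linear)
  from has_derivative_locally_injective[where f' = D, OF O(2,1) this g'(2) der onorm_near]
  obtain r1 where r1: "r1 > 0" "ball a r1 \<subseteq> O'" "inj_on g (ball a r1)"
    by blast
  obtain B where B: "B > 0" "\<And>x. B * norm x \<le> norm (D a x)"
    using linear_inj_bounded_below_pos[OF lin[OF O(2)] injD] by blast
  obtain d where d: "d > 0" "\<And>y. dist a y < d \<Longrightarrow> y \<in> O' \<and> onorm (\<lambda>v. D y v - D a v) < B"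
    using near[OF B(1)] by blast
  have "inj (D y)" if y: "dist a y < d" for y
  proof -
    have yO: "y \<in> O'" using d(2)[OF y] by blast
    have "bounded_linear (\<lambda>v. D y v - D a v)"
      using lin[OF yO] lin[OF O(2)] by (simp add: bounded_linear_sub linear_conv_bounded_linear)
    then have "norm (D y v - D a v) \<le> onorm (\<lambda>v. D y v - D a v) * norm v" for v
      by (rule onorm)
    then have le: "norm (D y v - D a v) \<le> onorm (\<lambda>v. D y v - D a v) * norm v" for v .
    have "v = 0" if v: "D y v = 0" for v
    proof (rule ccontr)
      assume "v \<noteq> 0"
      then have "onorm (\<lambda>v. D y v - D a v) * norm v < B * norm v"
        using d(2)[OF y] by simp
      then show False using le[of v] B(2)[of v] v by simp
    qed
    then show ?thesis using linear_injective_0[OF lin[OF yO]] by blast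
  qed
  note injD = this
  have sub: "ball a (min r1 d) \<subseteq> ball a r1" by (rule subset_ball) simp
  show thesis
  proof (rule that[of "min r1 d"])
    show "min r1 d > 0" using r1(1) d(1) by simp
    show "ball a (min r1 d) \<subseteq> O'" using sub r1(2) by (rule order_trans)
    show "inj_on g (ball a (min r1 d))" using r1(3) sub by (rule inj_on_subset)
    show "inj (frechet_derivative g (at y))" if "y \<in> ball a (min r1 d)" for y
      using injD[of y] that by (simp add: D_def)
  qed
qed

text \<open>
  At a local maximum of the height in direction \<open>v\<close> the tangent image is contained in \<open>v\<^sup>\<bottom>\<close>, and the
  dimensions agree.
\<close>

lemma tangent_space_at_local_max:
  fixes f :: "'a \<Rightarrow> real ^ 'n::finite" and A :: "('a, 'm::finite) chart set"
  assumes n: "CARD('n) = CARD('m) + 1"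
    and X: "smooth_manifold X A" and f: "immersion X A f"
    and W: "openin X W" "x \<in> W" and v: "v \<noteq> 0"
    and max: "\<And>z. z \<in> W \<Longrightarrow> f z \<bullet> v \<le> f x \<bullet> v"
  shows "differential A f x ` tangent_space A x = {u. v \<bullet> u = 0}"
proof -
  have x: "x \<in> topspace X" using W openin_subset by blast
  obtain c where c: "c \<in> charts_at A x" using charts_at_nonempty[OF X x] by blast
  then have ch: "is_chart X c" "x \<in> fst c"
    using X unfolding smooth_manifold_def charts_at_def by auto
  have sm: "smooth_map A f" using f by (simp add: immersion_def)
  define D where "D = frechet_derivative (f \<circ> chart_inv c) (at (snd c x))"
  have der: "((f \<circ> chart_inv c) has_derivative D) (at (snd c x))"
    unfolding D_def by (rule smooth_map_has_derivative[OF sm c])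
  have "openin X (W \<inter> fst c)" using W(1) ch(1) by (simp add: is_chart_def openin_Int)
  then have op: "open (snd c ` (W \<inter> fst c))" by (rule is_chart_open_image[OF ch(1)]) blast
  have "(\<lambda>w. D w \<bullet> v) = (\<lambda>w. 0)"
  proof (rule differential_zero_maxmin[OF _ op])
    show "snd c x \<in> snd c ` (W \<inter> fst c)" using W ch by blast
    show "((\<lambda>y. (f \<circ> chart_inv c) y \<bullet> v) has_derivative (\<lambda>w. D w \<bullet> v)) (at (snd c x))"
      by (rule has_derivative_inner_left[OF der])
    show "(\<forall>y\<in>snd c ` (W \<inter> fst c). (f \<circ> chart_inv c) y \<bullet> v \<le> (f \<circ> chart_inv c) (snd c x) \<bullet> v) \<or>
      (\<forall>y\<in>snd c ` (W \<inter> fst c). (f \<circ> chart_inv c) (snd c x) \<bullet> v \<le> (f \<circ> chart_inv c) y \<bullet> v)"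
      using is_chart_inv[OF ch(1)] ch(2) max by auto
  qed
  then have "D w \<bullet> v = 0" for w by (rule fun_cong)
  then have sub: "differential A f x ` tangent_space A x \<subseteq> {u. v \<bullet> u = 0}"
    unfolding differential_image[OF X sm c] D_def[symmetric] by (auto simp: inner_commute)
  show ?thesis
  proof (rule subspace_dim_equal[OF _ _ sub])
    show "subspace (differential A f x ` tangent_space A x)"
      by (rule tangent_hyperplane[OF X f x])
    show "subspace {u. v \<bullet> u = 0}" by (rule subspace_hyperplane)
    show "dim {u. v \<bullet> u = 0} \<le> dim (differential A f x ` tangent_space A x)"
      using tangent_hyperplane(2)[OF X f x] dim_hyperplane[OF v] n by simp
  qed
qed

text \<open>
  Take \<open>q\<close> to maximise the distance from \<open>f q\<close> to a centre \<open>e\<close>, and \<open>\<nu>\<close> the outer unit normal at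
  \<open>f q\<close> of the sphere around \<open>e\<close> through \<open>f q\<close>. The ball bounded by this sphere contains the image of
  \<open>f\<close> and touches its tangent hyperplane at \<open>f q\<close> only. Hence any other point of maximal
  height is mapped to \<open>f q\<close> as well. There the tangent images of both points would be \<open>\<nu>\<^sup>\<bottom>\<close>, whose
  self-intersection has codimension 1 and not 2, against normal crossings.
\<close>

lemma strict_extreme_point_exists:
  fixes f :: "'a \<Rightarrow> real ^ 'n::finite" and A :: "('a, 'm::finite) chart set"
  assumes n: "CARD('n) = CARD('m) + 1"
    and X: "closed_manifold X A" and ne: "topspace X \<noteq> {}"
    and f: "immersion_with_normal_crossings X A f"
  obtains q \<nu> where "q \<in> topspace X" "norm \<nu> = 1"
    "\<And>x. x \<in> topspace X \<Longrightarrow> x \<noteq> q \<Longrightarrow> f x \<bullet> \<nu> < f q \<bullet> \<nu>"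
proof -
  have sm: "smooth_manifold X A" and imm: "immersion X A f"
    using X f by (auto simp: closed_manifold_def immersion_with_normal_crossings_def)
  have "compactin X (topspace X)" using X by (simp add: closed_manifold_def compact_space_def)
  then have cpt: "compact (f ` topspace X)"
    using image_compactin[OF _ smooth_map_continuous[OF sm]] imm by (auto simp: immersion_def)
  obtain x0 where x0: "x0 \<in> topspace X" using ne by blast
  \<comment> \<open>A centre different from one point of the image, so that the maximal distance is positive.\<close>
  define e where "e = f x0 + 1"
  have "continuous_on (f ` topspace X) (\<lambda>y. norm (y - e))" by (intro continuous_intros)
  from continuous_attains_sup[OF cpt _ this] ne
  obtain q where q: "q \<in> topspace X"
    "\<And>x. x \<in> topspace X \<Longrightarrow> norm (f x - e) \<le> norm (f q - e)" by blast
  define R where "R = norm (f q - e)"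
  have "norm (f x0 - e) > 0" by (simp add: e_def)
  then have R: "R > 0" using q(2)[OF x0] unfolding R_def by linarith
  define \<nu> where "\<nu> = (f q - e) /\<^sub>R R"
  have nu: "norm \<nu> = 1" using R by (simp add: \<nu>_def R_def)
  have fq: "f q - e = R *\<^sub>R \<nu>" using R by (simp add: \<nu>_def)
  have nn: "\<nu> \<bullet> \<nu> = 1" using nu by (simp add: norm_eq_1)
  \<comment> \<open>On the ball, the height deficit bounds the distance to the touching point.\<close>
  have dist: "(norm (f x - f q))\<^sup>2 \<le> 2 * R * ((f q - f x) \<bullet> \<nu>)" if "x \<in> topspace X" for x
  proof -
    define w where "w = f x - e"
    have "(norm w)\<^sup>2 \<le> R\<^sup>2"
      unfolding R_def w_def using q(2)[OF that] by (simp add: power_mono)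
    then have "w \<bullet> w \<le> R * R" by (simp add: power2_norm_eq_inner flip: power2_eq_square)
    then have "(norm (w - R *\<^sub>R \<nu>))\<^sup>2 \<le> 2 * R * ((R *\<^sub>R \<nu> - w) \<bullet> \<nu>)"
      by (simp add: power2_norm_eq_inner inner_diff_left inner_diff_right inner_commute nn
          algebra_simps)
    moreover have "f x - f q = w - R *\<^sub>R \<nu>" "f q - f x = R *\<^sub>R \<nu> - w"
      using fq by (auto simp: w_def algebra_simps)
    ultimately show ?thesis by (simp only:)
  qed
  have le: "f x \<bullet> \<nu> \<le> f q \<bullet> \<nu>" if "x \<in> topspace X" for x
  proof -
    have "0 \<le> 2 * R * ((f q - f x) \<bullet> \<nu>)" using dist[OF that] zero_le_power2 order_trans by blast
    then show ?thesis using R by (simp add: zero_le_mult_iff inner_diff_left)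
  qed
  have nu0: "\<nu> \<noteq> 0" using nu by auto
  have "x = q" if x: "x \<in> topspace X" and eq: "f x \<bullet> \<nu> = f q \<bullet> \<nu>" for x
  proof (rule ccontr)
    assume "x \<noteq> q"
    have "f x = f q" using dist[OF x] eq by (simp add: inner_diff_left)
    then have "codim (\<Inter>z\<in>{x, q}. differential A f z ` tangent_space A z) =
        (\<Sum>z\<in>{x, q}. codim (differential A f z ` tangent_space A z))"
      using f x q(1) unfolding immersion_with_normal_crossings_def normal_crossings_at_def
      by (metis (mono_tags, lifting) empty_subsetI insert_subset mem_Collect_eq)
    moreover have "differential A f z ` tangent_space A z = {u. \<nu> \<bullet> u = 0}" if "z \<in> {x, q}" for z
      using that x q(1) le eq
      by (intro tangent_space_at_local_max[OF n sm imm openin_topspace _ nu0]) auto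
    moreover have "codim {u. \<nu> \<bullet> u = 0} = 1"
      using dim_hyperplane[OF nu0] n by (simp add: codim_def)
    ultimately show False using \<open>x \<noteq> q\<close> by simp
  qed
  then show thesis using that[OF q(1) nu] le by (metis order_le_less)
qed

text \<open>
  The hyperplane \<open>y \<bullet> \<nu> = h\<close> is placed slightly below a strict highest point \<open>f q\<close>. By compactness
  all points whose height is at least that of the mirror image of \<open>f q\<close> lie in a small
  neighbourhood \<open>U\<close> of \<open>q\<close> in which the image is a graph over \<open>\<nu>\<^sup>\<bottom>\<close>. A mirror pair has both points
  in \<open>U\<close> and on one vertical line, so the two points coincide; for the same reason \<open>f\<close> is injective over
  the hyperplane, and \<open>\<nu>\<close> is nowhere tangent along it.
  
  The last property says that the slice affinely spans the hyperplane. If a functional \<open>v\<close> that is not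
  proportional to \<open>\<nu>\<close> were constant on the slice, then some nonzero horizontal \<open>v'\<close> would be too.
  Its extrema over the compact cap above the hyperplane cannot be attained strictly above it,
  where a critical point of \<open>v'\<close> would make \<open>\<nu>\<close> tangent. Both are therefore attained on the slice, so
  \<open>v'\<close> is constant on the whole cap, and the highest point itself is such a critical point.
\<close>

lemma cap_hyperplane_exists:
  fixes f :: "'a \<Rightarrow> real ^ 'n::finite" and A :: "('a, 'm::finite) chart set"
  assumes n: "CARD('n) = CARD('m) + 1"
    and X: "closed_manifold X A" and ne: "topspace X \<noteq> {}"
    and f: "immersion_with_normal_crossings X A f"
  obtains \<nu> h where "norm \<nu> = 1"
    "\<And>x y. x \<in> topspace X \<Longrightarrow> y \<in> topspace X \<Longrightarrow> f x \<bullet> \<nu> + f y \<bullet> \<nu> = 2 * h \<Longrightarrow>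
       f x - f y = ((f x - f y) \<bullet> \<nu>) *\<^sub>R \<nu> \<Longrightarrow> x = y"
    "\<And>x. x \<in> topspace X \<Longrightarrow> f x \<bullet> \<nu> = h \<Longrightarrow> \<nu> \<notin> differential A f x ` tangent_space A x"
    "\<And>v b. (\<And>x. x \<in> topspace X \<Longrightarrow> f x \<bullet> \<nu> = h \<Longrightarrow> f x \<bullet> v = b) \<Longrightarrow> v = (v \<bullet> \<nu>) *\<^sub>R \<nu>"
proof -
  have sm: "smooth_manifold X A" and imm: "immersion X A f" and smf: "smooth_map A f"
    using X f by (auto simp: closed_manifold_def immersion_with_normal_crossings_def immersion_def)
  have cX: "compactin X (topspace X)"
    using X by (simp add: closed_manifold_def compact_space_def)
  have cf: "continuous_map X euclidean f" by (rule smooth_map_continuous[OF sm smf])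
  have cpt: "compact (f ` K)" if "compactin X K" for K
    using image_compactin[OF that cf] by simp
  obtain q \<nu> where q: "q \<in> topspace X" and nu: "norm \<nu> = 1"
    and lt: "\<And>x. x \<in> topspace X \<Longrightarrow> x \<noteq> q \<Longrightarrow> f x \<bullet> \<nu> < f q \<bullet> \<nu>"
    using strict_extreme_point_exists[OF n X ne f] by blast
  have nn: "\<nu> \<bullet> \<nu> = 1" using nu by (simp add: norm_eq_1)
  have nu0: "\<nu> \<noteq> 0" using nu by auto
  define \<beta> where "\<beta> = f q \<bullet> \<nu>"
  have le: "f x \<bullet> \<nu> \<le> \<beta>" if "x \<in> topspace X" for x
    using lt[OF that] unfolding \<beta>_def by (metis order_le_less)

  obtain c where c: "c \<in> charts_at A q" using charts_at_nonempty[OF sm q] by blast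
  then have cA: "c \<in> A" and ch: "is_chart X c" "q \<in> fst c"
    using sm unfolding smooth_manifold_def charts_at_def by auto
  define O' where "O' = snd c ` fst c"
  define a where "a = snd c q"
  \<comment> \<open>\<open>P\<close> is the orthogonal projection along \<open>\<nu>\<close> and \<open>g\<close> the horizontal part of \<open>f\<close> in the chart \<open>c\<close>.
    Since the tangent image at \<open>q\<close> is horizontal, \<open>P\<close> does not affect the derivative there.\<close>
  define P where "P = (\<lambda>y. y - (y \<bullet> \<nu>) *\<^sub>R \<nu>)"
  have P: "bounded_linear P"
    unfolding P_def by (intro bounded_linear_sub bounded_linear_ident
        bounded_linear_compose[OF bounded_linear_scaleR_left bounded_linear_inner_left])
  define L where "L = f \<circ> chart_inv c"
  define D where "D y = frechet_derivative L (at y)" for y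
  define g where "g = (\<lambda>y. P (L y))"
  have O': "open O'" "a \<in> O'" using ch by (auto simp: O'_def a_def is_chart_def)
  have CkL: "Ck_on k O' L" for k
    using smf cA by (simp add: smooth_map_def smooth_on_def O'_def L_def)
  have Ckg: "Ck_on (Suc 0) O' g"
    unfolding g_def by (rule Ck_on_bounded_linear[OF O'(1) P CkL])
  have derL: "(L has_derivative D y) (at y)" if "y \<in> O'" for y
    unfolding D_def by (rule Ck_on_Suc_has_derivative[OF CkL that])
  have derg: "frechet_derivative g (at y) = (\<lambda>w. P (D y w))" if "y \<in> O'" for y
    unfolding g_def
    by (rule frechet_derivative_at[OF bounded_linear.has_derivative[OF P derL[OF that]], symmetric])
  have image: "differential A f x ` tangent_space A x = range (D (snd c x))" if "x \<in> fst c" for x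
    using differential_image[OF sm smf, of c x] cA that by (simp add: charts_at_def D_def L_def)
  have "differential A f q ` tangent_space A q = {u. \<nu> \<bullet> u = 0}"
    using tangent_space_at_local_max[OF n sm imm openin_topspace q nu0] le by (simp add: \<beta>_def)
  then have "\<nu> \<bullet> D a w = 0" for w
    using image[OF ch(2)] unfolding a_def by blast
  then have "frechet_derivative g (at a) = D a"
    using derg[OF O'(2)] by (simp add: P_def inner_commute)
  then have "inj (frechet_derivative g (at a))"
    using immersion_inj_in_chart[OF sm imm c] by (simp add: D_def L_def a_def)
  from C1_injective_derivative_locally_injective[OF O' Ckg this]
  obtain r where r: "r > 0" "ball a r \<subseteq> O'" "inj_on g (ball a r)"
    "\<And>y. y \<in> ball a r \<Longrightarrow> inj (frechet_derivative g (at y))" by blast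
  define U where "U = {x \<in> fst c. snd c x \<in> ball a r}"
  have U: "openin X U" unfolding U_def by (rule is_chart_open_preimage[OF ch(1)]) simp
  have qU: "q \<in> U" using ch r by (simp add: U_def a_def)
  have U_inj: "x = y" if "x \<in> U" "y \<in> U" "f x - f y = ((f x - f y) \<bullet> \<nu>) *\<^sub>R \<nu>" for x y
  proof -
    have inv: "chart_inv c (snd c x) = x" "chart_inv c (snd c y) = y"
      using is_chart_inv[OF ch(1)] that by (auto simp: U_def)
    have "P (f x) - P (f y) = (f x - f y) - ((f x - f y) \<bullet> \<nu>) *\<^sub>R \<nu>"
      by (simp add: P_def inner_diff_left algebra_simps)
    also have "\<dots> = 0" using that(3) by (rule right_minus_eq[THEN iffD2])
    finally have "g (snd c x) = g (snd c y)" using inv by (simp add: g_def L_def)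
    then have "snd c x = snd c y" using inj_onD[OF r(3)] that by (simp add: U_def)
    then show ?thesis using inv by metis
  qed
  have U_trans: "\<nu> \<notin> differential A f x ` tangent_space A x" if "x \<in> U" for x
  proof
    assume nu_in: "\<nu> \<in> differential A f x ` tangent_space A x"
    have y: "snd c x \<in> ball a r" "snd c x \<in> O'" using that r(2) by (auto simp: U_def)
    have "x \<in> fst c" using that by (simp add: U_def)
    then have "\<nu> \<in> range (D (snd c x))" using nu_in image by simp
    then obtain w where w: "\<nu> = D (snd c x) w" by blast
    have "P (D (snd c x) w) = 0" using nn by (simp add: P_def flip: w)
    moreover have D0: "D (snd c x) 0 = 0"
      by (rule linear_0[OF has_derivative_linear[OF derL[OF y(2)]]])
    moreover have "P 0 = 0" by (simp add: P_def)
    ultimately have "w = 0"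
      using injD[OF r(4)[OF y(1)], of w 0] by (simp add: derg[OF y(2)])
    then show False using w D0 nu0 by simp
  qed

  \<comment> \<open>The mirror image of the highest level \<open>\<beta>\<close> is \<open>2 * h - \<beta>\<close>, the lowest level that must stay in \<open>U\<close>.\<close>
  have "\<exists>h<\<beta>. \<forall>x\<in>topspace X. f x \<bullet> \<nu> \<ge> 2 * h - \<beta> \<longrightarrow> x \<in> U"
  proof (cases "topspace X - U = {}")
    case True
    then show ?thesis by (intro exI[of _ "\<beta> - 1"]) auto
  next
    case False
    have "compactin X (topspace X - U)"
      using closed_compactin[OF cX, of "topspace X - U"] U by blast
    moreover have "continuous_on (f ` (topspace X - U)) (\<lambda>y. y \<bullet> \<nu>)"
      by (intro continuous_intros)
    ultimately obtain z where z: "z \<in> topspace X - U"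
      "\<And>x. x \<in> topspace X - U \<Longrightarrow> f x \<bullet> \<nu> \<le> f z \<bullet> \<nu>"
      using continuous_attains_sup[OF cpt, of "topspace X - U" "\<lambda>y. y \<bullet> \<nu>"] False by blast
    have "f z \<bullet> \<nu> < \<beta>" using lt[of z] z(1) qU by (auto simp: \<beta>_def)
    define h where "h = (f z \<bullet> \<nu> + 3 * \<beta>) / 4"
    have h: "h < \<beta>" "f z \<bullet> \<nu> < 2 * h - \<beta>" using \<open>f z \<bullet> \<nu> < \<beta>\<close> by (simp_all add: h_def field_simps)
    have "x \<in> U" if "x \<in> topspace X" "f x \<bullet> \<nu> \<ge> 2 * h - \<beta>" for x
    proof (rule ccontr)
      assume "x \<notin> U"
      then have "f x \<bullet> \<nu> \<le> f z \<bullet> \<nu>" using z(2) that(1) by blast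
      then show False using that(2) h(2) by linarith
    qed
    then show ?thesis using h(1) by blast
  qed
  then obtain h where h: "h < \<beta>"
    and hU: "\<And>x. x \<in> topspace X \<Longrightarrow> f x \<bullet> \<nu> \<ge> 2 * h - \<beta> \<Longrightarrow> x \<in> U" by blast

  show thesis
  proof (rule that[OF nu, of h])
    fix x y
    assume "x \<in> topspace X" "y \<in> topspace X" "f x \<bullet> \<nu> + f y \<bullet> \<nu> = 2 * h"
      "f x - f y = ((f x - f y) \<bullet> \<nu>) *\<^sub>R \<nu>"
    moreover from this have "x \<in> U" "y \<in> U"
      using hU[of x] hU[of y] le[of x] le[of y] by auto
    ultimately show "x = y" using U_inj by blast
  next
    fix x assume "x \<in> topspace X" "f x \<bullet> \<nu> = h"
    then show "\<nu> \<notin> differential A f x ` tangent_space A x"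
      using h by (intro U_trans hU) auto
  next
    fix v b
    assume b: "\<And>x. x \<in> topspace X \<Longrightarrow> f x \<bullet> \<nu> = h \<Longrightarrow> f x \<bullet> v = b"
    show "v = (v \<bullet> \<nu>) *\<^sub>R \<nu>"
    proof (rule ccontr)
      assume "v \<noteq> (v \<bullet> \<nu>) *\<^sub>R \<nu>"
      define v' where "v' = v - (v \<bullet> \<nu>) *\<^sub>R \<nu>"
      define b' where "b' = b - (v \<bullet> \<nu>) * h"
      have v0: "v' \<noteq> 0" using \<open>v \<noteq> _\<close> by (simp add: v'_def)
      have v\<nu>: "v' \<bullet> \<nu> = 0" using nn by (simp add: v'_def inner_diff_left)
      have b': "f x \<bullet> v' = b'" if "x \<in> topspace X" "f x \<bullet> \<nu> = h" for x
        using b[OF that] that by (simp add: v'_def b'_def inner_diff_right)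
      define V where "V = {x \<in> topspace X. f x \<bullet> \<nu> > h}"
      have V: "openin X V"
      proof -
        have "openin X {x \<in> topspace X. f x \<in> {y. y \<bullet> \<nu> > h}}"
          by (rule openin_continuous_map_preimage[OF cf])
             (simp add: open_halfspace_component_gt open_Collect_less continuous_intros)
        then show ?thesis by (simp add: V_def)
      qed
      have no_max: False
        if x: "x \<in> V" and max: "\<And>z. z \<in> V \<Longrightarrow> f z \<bullet> w \<le> f x \<bullet> w" and w: "w \<noteq> 0" "w \<bullet> \<nu> = 0" for x w
      proof -
        have "x \<in> U" using x h by (intro hU) (auto simp: V_def)
        moreover have "\<nu> \<in> differential A f x ` tangent_space A x"
          using w(2) by (simp add: tangent_space_at_local_max[OF n sm imm V x w(1) max])
        ultimately show False using U_trans by blast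
      qed
      define C where "C = f ` topspace X \<inter> {y. y \<bullet> \<nu> \<ge> h}"
      have "closed {y. y \<bullet> \<nu> \<ge> h}" by (intro closed_Collect_le continuous_intros)
      then have C: "compact C" unfolding C_def by (rule compact_Int_closed[OF cpt[OF cX]])
      have "f q \<in> C" using q h by (auto simp: C_def \<beta>_def)
      then have neC: "C \<noteq> {}" by blast
      \<comment> \<open>The factor \<open>s\<close> treats the maximum (\<open>s = 1\<close>) and the minimum (\<open>s = -1\<close>) of \<open>v'\<close> at once.\<close>
      have bound: "f z \<bullet> w \<le> b' * s"
        if z: "z \<in> topspace X" "f z \<bullet> \<nu> \<ge> h" and w: "w = s *\<^sub>R v'" "s \<noteq> 0" for z w s
      proof -
        have "continuous_on C (\<lambda>y. y \<bullet> w)" by (intro continuous_intros)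
        from continuous_attains_sup[OF C neC this]
        obtain x where x: "x \<in> topspace X" "f x \<bullet> \<nu> \<ge> h"
          "\<And>y. y \<in> topspace X \<Longrightarrow> f y \<bullet> \<nu> \<ge> h \<Longrightarrow> f y \<bullet> w \<le> f x \<bullet> w"
          unfolding C_def by auto
        have "x \<notin> V" 
        proof
          assume "x \<in> V"
          then show False
            by (rule no_max[of x w]) (use x(3) w v0 v\<nu> in \<open>auto simp: V_def\<close>)
        qed
        then have "\<not> h < f x \<bullet> \<nu>" using x(1) by (simp add: V_def)
        then have "f x \<bullet> \<nu> = h" using x(2) by linarith
        then have "f x \<bullet> w = b' * s" using b'[OF x(1)] w by simp
        then show ?thesis using x(3)[OF z] by simp
      qed
      have const: "f z \<bullet> v' = b'" if "z \<in> topspace X" "f z \<bullet> \<nu> \<ge> h" for z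
        using bound[OF that, of v' 1] bound[OF that, of "- v'" "-1"] by simp
      show False
        by (rule no_max[of q v']) (use q h v0 v\<nu> const in \<open>auto simp: V_def \<beta>_def\<close>)
    qed
  qed
qed

text \<open>
  An affine basis of \<open>\<Gamma>\<close> has at most \<open>CARD('n)\<close> elements because \<open>\<Gamma>\<close> lies in a hyperplane, so it can be
  enumerated by \<open>'n\<close>. Repetitions in the enumeration are harmless for the spanning property.
\<close>

lemma spanning_family_exists:
  fixes \<Gamma> :: "(real ^ 'n::finite) set"
  assumes n: "CARD('n) \<ge> 2" and nu: "norm \<nu> = 1" and h: "\<And>y. y \<in> \<Gamma> \<Longrightarrow> y \<bullet> \<nu> = h"
    and span: "\<And>v b. (\<And>y. y \<in> \<Gamma> \<Longrightarrow> y \<bullet> v = b) \<Longrightarrow> v = (v \<bullet> \<nu>) *\<^sub>R \<nu>"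
  obtains p :: "'n \<Rightarrow> real ^ 'n" where "\<And>j. p j \<in> \<Gamma>"
    "\<forall>v. (\<forall>j k. (p j - p k) \<bullet> v = 0) \<longrightarrow> v = (v \<bullet> \<nu>) *\<^sub>R \<nu>"
proof -
  have nu0: "\<nu> \<noteq> 0" using nu by auto
  obtain B where B: "B \<subseteq> \<Gamma>" "\<not> affine_dependent B" "affine hull \<Gamma> = affine hull B"
    using affine_basis_exists by blast
  have finB: "finite B" using B(2) by (rule aff_independent_finite)
  have "\<Gamma> \<noteq> {}"
  proof
    assume "\<Gamma> = {}"
    obtain v where v: "v \<noteq> 0" "orthogonal \<nu> v" using orthogonal_to_vector_exists[of \<nu>] n by auto
    have "v = (v \<bullet> \<nu>) *\<^sub>R \<nu>" by (rule span[of v 0]) (use \<open>\<Gamma> = {}\<close> in blast)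
    also have "\<dots> = 0" using v(2) by (simp add: orthogonal_def inner_commute)
    finally show False using v(1) by blast
  qed
  then have neB: "B \<noteq> {}" using B(3) by auto
  have "aff_dim \<Gamma> \<le> aff_dim {y. \<nu> \<bullet> y = h}"
    by (rule aff_dim_subset) (use h in \<open>auto simp: inner_commute\<close>)
  also have "\<dots> = int CARD('n) - 1" using aff_dim_hyperplane[OF nu0] by simp
  finally have "card B \<le> CARD('n)" using aff_dim_unique[of B \<Gamma>] B by simp
  then obtain e where e: "inj_on e B" "e ` B \<subseteq> (UNIV :: 'n set)"
    using card_le_inj[OF finB, of "UNIV :: 'n set"] by auto
  define p where "p j = (if j \<in> e ` B then inv_into B e j else (SOME y. y \<in> B))" for j
  have pB: "p j \<in> B" for j
    unfolding p_def using inv_into_into[of j e B] some_in_eq[of B] neB by simp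
  have surj: "\<exists>j. y = p j" if "y \<in> B" for y
    using that e(1) by (intro exI[of _ "e y"]) (simp add: p_def)
  show thesis
  proof (rule that[of p])
    show "p j \<in> \<Gamma>" for j using pB B(1) by blast
    show "\<forall>v. (\<forall>j k. (p j - p k) \<bullet> v = 0) \<longrightarrow> v = (v \<bullet> \<nu>) *\<^sub>R \<nu>"
    proof (intro allI impI)
      fix v assume v: "\<forall>j k. (p j - p k) \<bullet> v = 0"
      define b where "b = p undefined \<bullet> v"
      have "B \<subseteq> {y. v \<bullet> y = b}"
      proof
        fix y assume "y \<in> B"
        then obtain j where "y = p j" using surj by blast
        then have "y \<bullet> v = b" using v[rule_format, of j undefined] by (simp add: b_def inner_diff_left)
        then show "y \<in> {y. v \<bullet> y = b}" by (simp add: inner_commute)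
      qed
      then have "affine hull B \<subseteq> {y. v \<bullet> y = b}" by (rule hull_minimal) (rule affine_hyperplane)
      then have "\<Gamma> \<subseteq> {y. v \<bullet> y = b}" using B(3) hull_subset[of \<Gamma> affine] by blast
      then have "y \<bullet> v = b" if "y \<in> \<Gamma>" for y using that by (auto simp: inner_commute)
      then show "v = (v \<bullet> \<nu>) *\<^sub>R \<nu>" by (rule span)
    qed
  qed
qed

section \<open>The fold of an immersion with normal crossings\<close>

lemma codim_bij_linear_image:
  fixes L :: "'b::euclidean_space \<Rightarrow> 'b"
  assumes "linear L" "inj L"
  shows "codim (L ` H) = codim H"
  unfolding codim_def by (subst dim_image_eq)
    (use assms(1) inj_on_subset[OF assms(2) subset_UNIV] in simp_all)

theorem corollary1p3:
  fixes X :: "'a topology"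
    and A :: "('a, 'm::finite) chart set"
    and i :: "'a \<Rightarrow> real ^ 'n::finite"
  assumes "CARD('n) = CARD('m) + 1"
    and "closed_manifold X A"
    and "topspace X \<noteq> {}"
    and "immersion_with_normal_crossings X A i"
  shows "\<exists>p :: 'n \<Rightarrow> real ^ 'n.
           (\<forall>j. p j \<in> i ` topspace X) \<and>
           immersion_with_normal_crossings X A (distance_squared_mapping p \<circ> i)"
proof -
  obtain \<nu> h where nu: "norm \<nu> = 1"
    and graph: "\<And>x y. x \<in> topspace X \<Longrightarrow> y \<in> topspace X \<Longrightarrow> i x \<bullet> \<nu> + i y \<bullet> \<nu> = 2 * h \<Longrightarrow>
       i x - i y = ((i x - i y) \<bullet> \<nu>) *\<^sub>R \<nu> \<Longrightarrow> x = y"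
    and transverse: "\<And>x. x \<in> topspace X \<Longrightarrow> i x \<bullet> \<nu> = h \<Longrightarrow>
       \<nu> \<notin> differential A i x ` tangent_space A x"
    and slice: "\<And>v b. (\<And>x. x \<in> topspace X \<Longrightarrow> i x \<bullet> \<nu> = h \<Longrightarrow> i x \<bullet> v = b) \<Longrightarrow>
       v = (v \<bullet> \<nu>) *\<^sub>R \<nu>"
  proof (rule cap_hyperplane_exists[OF assms], goal_cases)
    case (1 \<nu> h)
    show ?case by (rule 1(1)[of \<nu> h]) (fact 1)+
  qed
  define \<Gamma> where "\<Gamma> = {y \<in> i ` topspace X. y \<bullet> \<nu> = h}"
  have "CARD('n) \<ge> 2" using assms(1) by simp
  moreover have "y \<bullet> \<nu> = h" if "y \<in> \<Gamma>" for y using that by (simp add: \<Gamma>_def)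
  moreover have "v = (v \<bullet> \<nu>) *\<^sub>R \<nu>" if "\<And>y. y \<in> \<Gamma> \<Longrightarrow> y \<bullet> v = b" for v b
    by (rule slice[of v b], rule that) (simp add: \<Gamma>_def)
  ultimately obtain p :: "'n \<Rightarrow> real ^ 'n" where p: "\<And>j. p j \<in> \<Gamma>"
    and span: "\<forall>v. (\<forall>j k. (p j - p k) \<bullet> v = 0) \<longrightarrow> v = (v \<bullet> \<nu>) *\<^sub>R \<nu>"
    using spanning_family_exists[OF _ nu, of \<Gamma> h] by metis
  have ph: "p j \<bullet> \<nu> = h" for j using p[of j] by (simp add: \<Gamma>_def)
  let ?D = "distance_squared_mapping p"
  define dD where "dD y = (\<lambda>v. (\<chi> j. 2 * ((y - p j) \<bullet> v)) :: real ^ 'n)" for y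
  have dD: "(?D has_derivative dD y) (at y)" for y
    unfolding dD_def by (rule distance_squared_has_derivative)
  have lin: "linear (dD y)" for y using dD by (rule has_derivative_linear)
  note kernel = distance_squared_kernel[where p = p and \<nu> = \<nu> and h = h, OF span ph, folded dD_def]
  have sm: "smooth_manifold X A" and imm: "immersion X A i" and smi: "smooth_map A i"
    using assms by (auto simp: closed_manifold_def immersion_with_normal_crossings_def immersion_def)
  have smD: "smooth_map A (?D \<circ> i)"
    unfolding smooth_map_def
  proof
    fix c assume c: "c \<in> A"
    have "is_chart X c" using sm c by (simp add: smooth_manifold_def)
    then have "smooth_on (snd c ` fst c) (?D \<circ> (i \<circ> chart_inv c))"
      using smi c by (intro smooth_on_distance_squared) (auto simp: is_chart_def smooth_map_def)
    then show "smooth_on (snd c ` fst c) (?D \<circ> i \<circ> chart_inv c)" by (simp add: comp_assoc)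
  qed
  have diff: "differential A (?D \<circ> i) x v = dD (i x) (differential A i x v)"
    if x: "x \<in> topspace X" for x v
  proof -
    define c where "c = (SOME c. c \<in> charts_at A x)"
    have c: "c \<in> charts_at A x"
      unfolding c_def using charts_at_nonempty[OF sm x] by (rule someI_ex)
    then have "is_chart X c" "x \<in> fst c"
      using sm unfolding smooth_manifold_def charts_at_def by auto
    then have inv: "(i \<circ> chart_inv c) (snd c x) = i x" by (simp add: is_chart_inv)
    have "((?D \<circ> (i \<circ> chart_inv c)) has_derivative
        dD (i x) \<circ> frechet_derivative (i \<circ> chart_inv c) (at (snd c x))) (at (snd c x))"
      by (rule diff_chain_at[OF smooth_map_has_derivative[OF smi c]]) (simp only: inv dD)
    from fun_cong[OF frechet_derivative_at[OF this], of "v c"] show ?thesis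
      unfolding differential_def Let_def c_def[symmetric] by (simp add: comp_assoc)
  qed
  have immD: "immersion X A (?D \<circ> i)"
    unfolding immersion_def
  proof (intro conjI smD ballI inj_onI)
    fix x v1 v2
    assume x: "x \<in> topspace X" and v: "v1 \<in> tangent_space A x" "v2 \<in> tangent_space A x"
      and eq: "differential A (?D \<circ> i) x v1 = differential A (?D \<circ> i) x v2"
    define u where "u = differential A i x v1 - differential A i x v2"
    have T: "subspace (differential A i x ` tangent_space A x)"
      by (rule tangent_hyperplane[OF sm imm x])
    have u: "u \<in> differential A i x ` tangent_space A x"
      unfolding u_def using v by (intro subspace_diff[OF T]) auto
    have "dD (i x) u = 0"
      using eq by (simp add: diff[OF x] u_def linear_diff[OF lin])
    note ker = kernel[OF this[unfolded dD_def]]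
    have "u = 0"
    proof (rule ccontr)
      assume u0: "u \<noteq> 0"
      define t where "t = u \<bullet> \<nu>"
      have ut: "u = t *\<^sub>R \<nu>" unfolding t_def by (rule ker(1))
      then have "(1 / t) *\<^sub>R u = \<nu>" using u0 by auto
      then have "\<nu> \<in> differential A i x ` tangent_space A x"
        using subspace_scale[OF T u] by metis
      then show False using transverse[OF x] ker(2) u0 by blast
    qed
    then have "differential A i x v1 = differential A i x v2" by (simp add: u_def)
    moreover have "inj_on (differential A i x) (tangent_space A x)"
      using imm x by (simp add: immersion_def)
    ultimately show "v1 = v2" using v by (meson inj_onD)
  qed
  have nc: "normal_crossings_at X A (?D \<circ> i) y" for y
  proof -
    define F where "F = {x \<in> topspace X. (?D \<circ> i) x = y}"
    define T where "T x = differential A i x ` tangent_space A x" for x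
    define TD where "TD x = differential A (?D \<circ> i) x ` tangent_space A x" for x
    have TD: "TD x = dD (i x) ` T x" if "x \<in> topspace X" for x
      unfolding TD_def T_def using diff[OF that] by (simp add: image_image)
    \<comment> \<open>Distinct points of a fibre are not exchanged by the reflection, so they already form a crossing of
      \<open>i\<close>, and this crossing is off the hyperplane.\<close>
    have fibre: "x = x' \<or> i x = i x' \<and> i x \<bullet> \<nu> \<noteq> h" if "x \<in> F" "x' \<in> F" for x x'
    proof -
      have eq: "?D (i x) = ?D (i x')" using that by (simp add: F_def)
      note fold = distance_squared_fibre[where p = p and \<nu> = \<nu> and h = h, OF span ph eq]
      have top: "x \<in> topspace X" "x' \<in> topspace X" using that by (auto simp: F_def)
      show ?thesis
      proof (cases "i x \<bullet> \<nu> + i x' \<bullet> \<nu> = 2 * h")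
        case True
        then show ?thesis using graph[OF top True fold(1)] by blast
      next
        case False
        then have "i x = i x'" using fold(2) by blast
        then show ?thesis using False by auto
      qed
    qed
    have "finite F \<and> (\<forall>S\<subseteq>F. codim (\<Inter>x\<in>S. TD x) = (\<Sum>x\<in>S. codim (TD x)))"
    proof (cases "\<exists>x. F \<subseteq> {x}")
      case True
      then obtain x where x: "F \<subseteq> {x}" by blast
      have "codim (\<Inter>x\<in>S. TD x) = (\<Sum>x\<in>S. codim (TD x))" if "S \<subseteq> F" for S
      proof -
        have "S = {} \<or> S = {x}" using that x by blast
        then show ?thesis by (auto simp: codim_def)
      qed
      moreover have "finite F" using x by (rule finite_subset) simp
      ultimately show ?thesis by blast
    next
      case False
      then obtain x0 where x0: "x0 \<in> F" by blast
      then obtain x1 where x1: "x1 \<in> F" "x1 \<noteq> x0" using False by blast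
      define z where "z = i x0"
      have z: "z \<bullet> \<nu> \<noteq> h" using fibre[OF x0 x1(1)] x1(2) z_def by blast
      have Fz: "F = {x \<in> topspace X. i x = z}"
        using fibre[OF _ x0] x0 unfolding z_def F_def by auto
      have inj: "inj (dD z)"
        using kernel(2)[of z] z linear_injective_0[OF lin] unfolding dD_def by blast
      have nci: "finite F" "\<And>S. S \<subseteq> F \<Longrightarrow> codim (\<Inter>x\<in>S. T x) = (\<Sum>x\<in>S. codim (T x))"
        using assms(4) unfolding immersion_with_normal_crossings_def normal_crossings_at_def Fz T_def
        by blast+
      have "codim (\<Inter>x\<in>S. TD x) = (\<Sum>x\<in>S. codim (TD x))" if S: "S \<subseteq> F" for S
      proof (cases "S = {}")
        case True
        then show ?thesis by (simp add: codim_def)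
      next
        case False
        have TDz: "TD x = dD z ` T x" if "x \<in> S" for x
          using TD[of x] that S by (auto simp: Fz)
        have "(\<Inter>x\<in>S. TD x) = dD z ` (\<Inter>x\<in>S. T x)"
          using image_INT[of "dD z" UNIV S T] inj False TDz by auto
        then show ?thesis
          using nci(2)[OF S] TDz by (simp add: codim_bij_linear_image[OF lin inj])
      qed
      then show ?thesis using nci(1) by blast
    qed
    then show ?thesis
      unfolding normal_crossings_at_def F_def TD_def .
  qed
  show ?thesis
    using p immD nc by (auto simp: \<Gamma>_def immersion_with_normal_crossings_def intro!: exI[of _ p])
qed

end
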